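(* Let $\mathcal O$ be the ring of integers of a number field and let $\Gamma=SL(2,\mathcal O)$. Let $K$ be a subgroup of $\Gamma$ of finite index, and suppose that the level of $K$ is $m$. Then $K$ is a congruence subgroup of $\Gamma$ if and only if $\Gamma(m)\subseteq K$.
   Context: Let $\{w_1=1,w_2,\dots,w_n\}$ be an integral basis of $\mathcal O$. For a nonzero ideal $\pi$ of $\mathcal O$, $\Gamma(\pi)=\{(a_{ij})\in\Gamma: a_{11}-1,\,a_{22}-1,\,a_{12},\,a_{21}\in\pi\}$; for a positive integer $m$, $\Gamma(m)$ means $\Gamma(m\mathcal O)$. A subgroup $K$ of $\Gamma$ is congruence if it contains $\Gamma(\pi)$ for some nonzero ideal $\pi\subseteq\mathcal O$. A finite index subgroup $K$ of $\Gamma$ has level $m$ if $m$ is the smallest positive integer such that the normal closure in $\Gamma$ of the subgroup generated by $\begin{pmatrix}1&mw_i\\0&1\end{pmatrix}$, $1\le i\le n$, is contained in $K$ (such an $m$ exists). *)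

theory Defs
  imports "HOL-Analysis.Analysis" "HOL-Algebra.Algebraic_Closure_Type"
begin

text \<open>Number fields are taken inside an ambient field of characteristic zero, which may be the
  number field itself or, for instance, the complex numbers.\<close>

definition number_field :: "'a::field_char_0 set \<Rightarrow> bool" where
  "number_field F \<longleftrightarrow>
     subfield F ring_of_type_algebra \<and> ring.finite_dimension ring_of_type_algebra \<rat> F"

definition integers_of :: "'a::field_char_0 set \<Rightarrow> 'a set" where
  "integers_of F = {x \<in> F. algebraic_int x}"

definition integers_ring :: "'a::field_char_0 set \<Rightarrow> 'a ring" where
  "integers_ring F = ring_of_type_algebra\<lparr>carrier := integers_of F\<rparr>"

global_interpretation int_module:
  Modules.module "\<lambda>(k::int) (x::'a::field_char_0). of_int k * x"
  by unfold_locales (simp_all add: algebra_simps)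

definition integral_basis :: "'a::field_char_0 set \<Rightarrow> nat \<Rightarrow> (nat \<Rightarrow> 'a) \<Rightarrow> bool" where
  "integral_basis F n w \<longleftrightarrow>
     inj_on w {1..n} \<and> int_module.independent (w ` {1..n}) \<and>
     int_module.span (w ` {1..n}) = integers_of F"

definition SL2 :: "'a::comm_ring_1 set \<Rightarrow> ('a^2^2) monoid" where
  "SL2 A = \<lparr>carrier = {M. (\<forall>i j. M $ i $ j \<in> A) \<and> det M = 1}, mult = (**), one = mat 1\<rparr>"

definition principal_congruence_subgroup :: "'a::field_char_0 set \<Rightarrow> 'a set \<Rightarrow> ('a^2^2) set" where
  "principal_congruence_subgroup F I =
     {M \<in> carrier (SL2 (integers_of F)).
        M $ 1 $ 1 - 1 \<in> I \<and> M $ 2 $ 2 - 1 \<in> I \<and> M $ 1 $ 2 \<in> I \<and> M $ 2 $ 1 \<in> I}"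

definition congruence_subgroup :: "'a::field_char_0 set \<Rightarrow> ('a^2^2) set \<Rightarrow> bool" where
  "congruence_subgroup F K \<longleftrightarrow>
     subgroup K (SL2 (integers_of F)) \<and>
     (\<exists>I. ideal I (integers_ring F) \<and> I \<noteq> {0} \<and> principal_congruence_subgroup F I \<subseteq> K)"

definition normal_closure :: "('g, 'b) monoid_scheme \<Rightarrow> 'g set \<Rightarrow> 'g set" where
  "normal_closure G H = \<Inter>{N. normal N G \<and> H \<subseteq> N}"

definition upper_unipotent :: "'a::comm_ring_1 \<Rightarrow> 'a^2^2" where
  "upper_unipotent x = vector [vector [1, x], vector [0, 1]]"

definition level_subgroup ::
    "'a::field_char_0 set \<Rightarrow> nat \<Rightarrow> (nat \<Rightarrow> 'a) \<Rightarrow> nat \<Rightarrow> ('a^2^2) set" where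
  "level_subgroup F n w m =
     normal_closure (SL2 (integers_of F))
       (generate (SL2 (integers_of F)) ((\<lambda>i. upper_unipotent (of_nat m * w i)) ` {1..n}))"

text \<open>A relation rather than a function of the subgroup: that a level exists for every subgroup of
  finite index is a fact, not part of the definition.\<close>

definition has_level ::
    "'a::field_char_0 set \<Rightarrow> nat \<Rightarrow> (nat \<Rightarrow> 'a) \<Rightarrow> ('a^2^2) set \<Rightarrow> nat \<Rightarrow> bool" where
  "has_level F n w K m \<longleftrightarrow>
     0 < m \<and> level_subgroup F n w m \<subseteq> K \<and>
     (\<forall>k>0. level_subgroup F n w k \<subseteq> K \<longrightarrow> m \<le> k)"

end

theory Submission
  imports Defs "Jordan_Normal_Form.Char_Poly"
begin

text \<open>If \<open>K\<close> is congruence, it contains \<open>\<Gamma>(D)\<close> for some positive integer \<open>D\<close>, so that only matrices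
  modulo \<open>D\<close> matter. Since \<open>\<O>/D\<close> is finite, it has stable range one: a matrix in \<open>\<Gamma>(m)\<close> can be
  multiplied by a lower unipotent matrix with entry in \<open>m\<O>\<close> so that its upper left corner becomes a
  unit modulo \<open>D\<close>. Such a matrix is congruent modulo \<open>D\<close> to a product of conjugates of unipotent
  matrices with entries in \<open>m\<O>\<close>, and those lie in \<open>K\<close> by the definition of the level.\<close>

section \<open>Algebraic integers form a ring\<close>

text \<open>The vector of generators is an eigenvector, with eigenvalue \<open>z\<close>, of an integer matrix, whose
  characteristic polynomial is monic.\<close>

lemma algebraic_int_if_stable_span:
  fixes z :: "'a::field_char_0"
  assumes B: "finite B" and b: "b \<in> B" "b \<noteq> 0"
    and stable: "\<And>c. c \<in> B \<Longrightarrow> z * c \<in> int_module.span B"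
  shows "algebraic_int z"
proof -
  define n where "n = card B"
  obtain f where f: "bij_betw f {..<n} B"
    using ex_bij_betw_nat_finite[OF B] by (auto simp: n_def atLeast0LessThan)
  have "\<exists>r. z * c = (\<Sum>d\<in>B. of_int (r d) * d)" if "c \<in> B" for c
    using stable[OF that] int_module.span_finite[OF B] by auto
  then obtain r where r: "\<And>c. c \<in> B \<Longrightarrow> z * c = (\<Sum>d\<in>B. of_int (r c d) * d)"
    by metis
  define A where "A = Matrix.mat n n (\<lambda>(i, j). r (f i) (f j))"
  define A' where "A' = map_mat (of_int :: int \<Rightarrow> 'a) A"
  define v where "v = Matrix.vec n f"
  have A: "A \<in> carrier_mat n n" and A': "A' \<in> carrier_mat n n"
    by (auto simp: A_def A'_def)
  obtain k where k: "k < n" "f k = b"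
    using f b by (force simp: bij_betw_def)
  have nz: "v \<noteq> 0\<^sub>v n"
    using k b by (metis v_def index_vec index_zero_vec(1))
  have "A' *\<^sub>v v = z \<cdot>\<^sub>v v"
  proof (rule eq_vecI)
    fix i assume "i < dim_vec (z \<cdot>\<^sub>v v)"
    hence i: "i < n" by (simp add: v_def)
    hence "f i \<in> B" using f by (auto simp: bij_betw_def)
    hence "z * f i = (\<Sum>j<n. of_int (r (f i) (f j)) * f j)"
      using r by (simp add: sum.reindex_bij_betw[OF f, symmetric])
    thus "vec_index (A' *\<^sub>v v) i = vec_index (z \<cdot>\<^sub>v v) i"
      using i by (simp add: A'_def A_def v_def scalar_prod_def atLeast0LessThan)
  qed (simp_all add: A'_def A_def v_def)
  hence "eigenvalue A' z"
    using nz A' by (auto simp: eigenvalue_def eigenvector_def v_def intro!: exI[of _ v])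
  hence "poly (char_poly A') z = 0"
    using eigenvalue_root_char_poly[OF A'] by simp
  moreover have "char_poly A' = map_poly of_int (char_poly A)"
    unfolding A'_def by (rule of_int_hom.char_poly_hom[OF A])
  moreover have "Polynomial.lead_coeff (char_poly A) = 1"
    using degree_monic_char_poly[OF A] by simp
  ultimately show ?thesis
    unfolding algebraic_int_altdef_ipoly by auto
qed

text \<open>The monic integer equation of \<open>x\<close>, solved for its leading term. The degree
  is positive because a monic constant is 1 and has no root.\<close>

lemma algebraic_int_power_in_span:
  fixes x :: "'a::field_char_0"
  assumes "algebraic_int x"
  obtains p where "p > 0" "x ^ p \<in> int_module.span ((\<lambda>i. x ^ i) ` {..<p})"
proof -
  obtain P where P: "poly (map_poly of_int P) x = 0" "Polynomial.lead_coeff P = 1"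
    using assms unfolding algebraic_int_altdef_ipoly by auto
  let ?p = "Polynomial.degree P"
  have deg: "Polynomial.degree (map_poly (of_int :: int \<Rightarrow> 'a) P) = ?p" 
    by (simp add: degree_map_poly)
  have "?p \<noteq> 0"
  proof
    assume "?p = 0"
    hence "P = 1" using P(2) by (metis degree_eq_zeroE Polynomial.lead_coeff_pCons(2) one_pCons degree_pCons_0 coeff_pCons_0)
    thus False using P(1) by simp
  qed
  moreover have "x ^ ?p \<in> int_module.span ((\<lambda>i. x ^ i) ` {..<?p})"
  proof -
    have "0 = (\<Sum>i\<le>?p. of_int (Polynomial.coeff P i) * x ^ i)"
      using P(1) by (simp add: poly_altdef deg coeff_map_poly)
    also have "\<dots> = (\<Sum>i<?p. of_int (Polynomial.coeff P i) * x ^ i) + x ^ ?p"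
      using P(2) by (simp add: lessThan_Suc_atMost[symmetric])
    finally have eq: "x ^ ?p = - (\<Sum>i<?p. of_int (Polynomial.coeff P i) * x ^ i)"
      by (simp add: eq_neg_iff_add_eq_0 add.commute)
    show ?thesis
      unfolding eq
      by (intro int_module.span_neg int_module.span_sum int_module.span_scale int_module.span_base) auto
  qed
  ultimately show ?thesis using that by blast
qed

lemma span_int_mult:
  fixes z :: "'a::field_char_0"
  assumes "\<And>c. c \<in> B \<Longrightarrow> z * c \<in> int_module.span C" and "u \<in> int_module.span B"
  shows "z * u \<in> int_module.span C"
  using assms(2)
proof (induction rule: int_module.span_induct_alt)
  case base
  show ?case by (simp add: int_module.span_zero)
next
  case (step k c u)
  have "z * (of_int k * c + u) = of_int k * (z * c) + z * u"
    by (simp add: algebra_simps)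
  thus ?case
    using step assms(1) by (auto intro!: int_module.span_add int_module.span_scale)
qed

text \<open>The finitely many products \<open>x ^ i * y ^ j\<close> with \<open>i < p\<close>,
  \<open>j < q\<close> include 1, and their integer span is stable under \<open>x\<close> and
  \<open>y\<close>: an exponent that reaches \<open>p\<close> or \<open>q\<close> is lowered again
  by the monic equation. So the span is stable under \<open>x + y\<close> and
  \<open>x * y\<close>.\<close>

lemma
  fixes x y :: "'a::field_char_0"
  assumes "algebraic_int x" "algebraic_int y"
  shows algebraic_int_add: "algebraic_int (x + y)"
    and algebraic_int_mult: "algebraic_int (x * y)"
proof -
  obtain p where p: "p > 0" "x ^ p \<in> int_module.span ((\<lambda>i. x ^ i) ` {..<p})"
    using algebraic_int_power_in_span[OF assms(1)] .
  obtain q where q: "q > 0" "y ^ q \<in> int_module.span ((\<lambda>i. y ^ i) ` {..<q})"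
    using algebraic_int_power_in_span[OF assms(2)] .
  define B where "B = (\<lambda>(i, j). x ^ i * y ^ j) ` ({..<p} \<times> {..<q})"
  have fin: "finite B" by (simp add: B_def)
  have one: "1 \<in> B" using p(1) q(1) by (force simp: B_def)
  have B: "x ^ i * y ^ j \<in> B" if "i < p" "j < q" for i j
    using that by (auto simp: B_def)
  have x: "x * c \<in> int_module.span B" if c: "c \<in> B" for c
  proof -
    obtain i j where ij: "i < p" "j < q" "c = x ^ i * y ^ j"
      using c by (auto simp: B_def)
    show ?thesis
    proof (cases "Suc i = p")
      case True
      have "y ^ j * x ^ p \<in> int_module.span B"
        by (rule span_int_mult[OF _ p(2)])
          (use B ij in \<open>auto simp: mult.commute[of "y ^ j"] intro!: int_module.span_base\<close>)
      moreover have "y ^ j * x ^ p = x * c"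
        using ij True by auto
      ultimately show ?thesis by simp
    next
      case False
      thus ?thesis using B[of "Suc i" j] ij by (auto simp: mult.assoc intro!: int_module.span_base)
    qed
  qed
  have y: "y * c \<in> int_module.span B" if c: "c \<in> B" for c
  proof -
    obtain i j where ij: "i < p" "j < q" "c = x ^ i * y ^ j"
      using c by (auto simp: B_def)
    show ?thesis
    proof (cases "Suc j = q")
      case True
      have "x ^ i * y ^ q \<in> int_module.span B"
        by (rule span_int_mult[OF _ q(2)])
          (use B ij in \<open>auto intro!: int_module.span_base\<close>)
      moreover have "x ^ i * y ^ q = y * c"
        using ij True by auto
      ultimately show ?thesis by simp
    next
      case False
      have "y * c = x ^ i * y ^ Suc j" using ij by simp
      thus ?thesis using B[of i "Suc j"] ij False by (metis Suc_lessI int_module.span_base)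
    qed
  qed
  show "algebraic_int (x + y)"
    by (rule algebraic_int_if_stable_span[OF fin one])
      (auto simp: distrib_right intro: int_module.span_add x y)
  show "algebraic_int (x * y)"
    by (rule algebraic_int_if_stable_span[OF fin one])
      (auto simp: mult.assoc intro: span_int_mult x y)
qed

section \<open>The ring of integers and its residues\<close>

locale integers_of_number_field =
  fixes F :: "'a::field_char_0 set"
  assumes number_field: "number_field F"
begin

abbreviation \<O> where "\<O> \<equiv> integers_of F"

lemma subring_F: "subring F (ring_of_type_algebra :: 'a ring)"
  using number_field by (auto simp: number_field_def subfield_def subdomain_def subcring_def)

lemma F_closed:
  shows "0 \<in> F" and "1 \<in> F"
    and "x \<in> F \<Longrightarrow> y \<in> F \<Longrightarrow> x + y \<in> F"
    and "x \<in> F \<Longrightarrow> y \<in> F \<Longrightarrow> x * y \<in> F"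
    and "x \<in> F \<Longrightarrow> - x \<in> F"
proof -
  \<comment> \<open>Negation in the ring record is defined abstractly; closure of \<open>F\<close>
    under it becomes usable once it is identified with unary minus.\<close>
  have neg: "\<ominus>\<^bsub>ring_of_type_algebra\<^esub> x = - x" for x :: 'a
    using ring_from_type_algebra[where ?'a = 'a]
    by (intro abelian_group.minus_equality) (auto simp: ring_of_type_algebra_def ring_def)
  note R = subringE[OF subring_F]
  show "0 \<in> F" "1 \<in> F" "x \<in> F \<Longrightarrow> y \<in> F \<Longrightarrow> x + y \<in> F"
    "x \<in> F \<Longrightarrow> y \<in> F \<Longrightarrow> x * y \<in> F"
    using R(2,3,6,7) by (auto simp: ring_of_type_algebra_def)
  show "x \<in> F \<Longrightarrow> - x \<in> F" using R(5) neg by simp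
qed

lemma integers_closed [simp, intro]:
  shows "0 \<in> \<O>" and "1 \<in> \<O>"
    and "x \<in> \<O> \<Longrightarrow> y \<in> \<O> \<Longrightarrow> x + y \<in> \<O>"
    and "x \<in> \<O> \<Longrightarrow> y \<in> \<O> \<Longrightarrow> x * y \<in> \<O>"
    and "x \<in> \<O> \<Longrightarrow> - x \<in> \<O>"
  using F_closed by (auto simp: integers_of_def algebraic_int_add algebraic_int_mult)

lemma integers_diff [simp, intro]: "x \<in> \<O> \<Longrightarrow> y \<in> \<O> \<Longrightarrow> x - y \<in> \<O>"
  using integers_closed(3)[of x "- y"] by simp

lemma integers_power [simp, intro]: "x \<in> \<O> \<Longrightarrow> x ^ k \<in> \<O>"
  by (induction k) auto

lemma integers_sum [intro]: "(\<And>i. i \<in> S \<Longrightarrow> f i \<in> \<O>) \<Longrightarrow> sum f S \<in> \<O>"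
  by (induction S rule: infinite_finite_induct) auto

lemma integers_of_nat [simp, intro]: "of_nat k \<in> \<O>"
  by (induction k) auto

lemma integers_of_int [simp, intro]: "of_int k \<in> \<O>"
  by (cases k) auto

lemma integers_poly: "x \<in> \<O> \<Longrightarrow> poly (map_poly of_int P) x \<in> \<O>"
  by (induction P) (auto simp: map_poly_pCons)

lemma cring_integers_ring: "cring (integers_ring F)"
proof -
  have "\<exists>y\<in>\<O>. x + y = 0" if "x \<in> \<O>" for x
    using that by (intro bexI[of _ "- x"]) auto
  thus ?thesis
    unfolding integers_ring_def ring_of_type_algebra_def
    by unfold_locales (auto simp: algebra_simps Units_def intro: add.left_inverse)
qed

lemma PIdl_integers_ring: "PIdl\<^bsub>integers_ring F\<^esub> a = {a * z | z. z \<in> \<O>}"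
  by (auto simp: cgenideal_def integers_ring_def ring_of_type_algebra_def mult.commute)

lemma ideal_mult_closed:
  assumes "ideal I (integers_ring F)" "x \<in> I" "z \<in> \<O>"
  shows "x * z \<in> I"
  using ideal.I_r_closed[OF assms(1,2), of z] assms(3)
  by (simp add: integers_ring_def ring_of_type_algebra_def)

text \<open>The constant term of an integer polynomial with root \<open>x\<close> is a multiple of
  \<open>x\<close>. This lets a rational integer \<open>D\<close> replace an arbitrary nonzero
  ideal.\<close>

lemma nonzero_ideal_contains_pos_nat:
  assumes I: "ideal I (integers_ring F)" "I \<noteq> {0}"
  obtains D :: nat where "D > 0" "of_nat D \<in> I"
proof -
  have add: "additive_subgroup I (integers_ring F)" using I(1) by (simp add: ideal_def)
  have "0 \<in> I"
    using additive_subgroup.zero_closed[OF add] by (simp add: integers_ring_def ring_of_type_algebra_def)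
  then obtain x where x: "x \<in> I" "x \<noteq> 0" using I(2) by blast
  have xO: "x \<in> \<O>"
    using additive_subgroup.a_Hcarr[OF add x(1)] by (simp add: integers_ring_def)
  \<comment> \<open>Induction on the coefficients: a zero constant term is dropped by cancelling
    \<open>x\<close>, and the first nonzero one serves as \<open>c\<close>.\<close>
  have "\<exists>c Q. c \<noteq> 0 \<and> of_int c = x * poly (map_poly of_int Q) x"
    if "P \<noteq> 0" "poly (map_poly of_int P) x = 0" for P :: "int poly"
    using that
  proof (induction P)
    case (pCons c P)
    have *: "of_int c + x * poly (map_poly of_int P) x = 0"
      using pCons.prems by (simp add: map_poly_pCons)
    show ?case
    proof (cases "c = 0")
      case True
      thus ?thesis using pCons * x(2) by auto
    next
      case False
      have "of_int c = x * poly (map_poly of_int (- P)) x"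
        using * by (simp add: hom_distribs eq_neg_iff_add_eq_0)
      thus ?thesis using False by blast
    qed
  qed auto
  moreover obtain P where "poly (map_poly of_int P) x = 0" "Polynomial.lead_coeff P = (1::int)"
    using xO by (auto simp: integers_of_def algebraic_int_altdef_ipoly)
  moreover from this have "P \<noteq> 0" by auto
  ultimately obtain c Q where c: "c \<noteq> 0" "of_int c = x * poly (map_poly of_int Q) x"
    by blast
  have "of_int c * of_int (sgn c) \<in> I"
    using ideal_mult_closed[OF I(1) x(1)] integers_poly[OF xO] c(2) by (metis ideal_mult_closed[OF I(1)] integers_of_int)
  moreover have "of_int c * of_int (sgn c) = (of_nat (nat \<bar>c\<bar>) :: 'a)"
    by (metis abs_ge_zero abs_sgn int_nat_eq of_int_mult of_int_of_nat_eq)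
  ultimately show ?thesis using that[of "nat \<bar>c\<bar>"] c(1) by simp
qed

end

section \<open>Congruence modulo an element and stable range one\<close>

context integers_of_number_field
begin

text \<open>Congruence modulo the multiples of \<open>d\<close> by elements of \<O>, kept as a
  relation on representatives so that no quotient ring has to be formed.\<close>

definition eqmod :: "'a \<Rightarrow> 'a \<Rightarrow> 'a \<Rightarrow> bool" where
  "eqmod d x y \<longleftrightarrow> (\<exists>z\<in>\<O>. x - y = d * z)"

lemma eqmod_refl [simp]: "eqmod d x x"
  by (auto simp: eqmod_def)

lemma eqmod_sym: "eqmod d x y \<Longrightarrow> eqmod d y x"
  unfolding eqmod_def by (metis integers_closed(5) minus_diff_eq mult_minus_right)

lemma eqmod_trans [trans]: 
  assumes "eqmod d x y" "eqmod d y z" shows "eqmod d x z"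
proof -
  obtain s t where "s \<in> \<O>" "t \<in> \<O>" "x - y = d * s" "y - z = d * t"
    using assms by (auto simp: eqmod_def)
  thus ?thesis unfolding eqmod_def
    by (intro bexI[of _ "s + t"]) (auto simp: algebra_simps)
qed

lemma eqmod_mult_left: "eqmod d x y \<Longrightarrow> z \<in> \<O> \<Longrightarrow> eqmod d (z * x) (z * y)"
  unfolding eqmod_def by (metis integers_closed(4) mult.left_commute right_diff_distrib)

lemma eqmod_add:
  assumes "eqmod d x y" "eqmod d x' y'" shows "eqmod d (x + x') (y + y')"
proof -
  obtain s t where "s \<in> \<O>" "t \<in> \<O>" "x - y = d * s" "x' - y' = d * t"
    using assms by (auto simp: eqmod_def)
  thus ?thesis unfolding eqmod_def
    by (intro bexI[of _ "s + t"]) (auto simp: algebra_simps)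
qed

text \<open>Modulo \<open>d\<close> the element \<open>e = a ^ n\<close> is idempotent. On the component \<open>e\<close> the element \<open>a\<close> is
  invertible, on the component \<open>1 - e\<close> it is nilpotent and \<open>a + y * c = 1 - (x - 1) * a\<close> is
  inverted by a geometric sum; hence \<open>t = (1 - e) * y\<close> works.\<close>

lemma eqmod_unit_stable:
  assumes O: "a \<in> \<O>" "c \<in> \<O>" "x \<in> \<O>" "y \<in> \<O>"
    and bezout: "x * a + y * c = 1"
    and n: "n > 0" "eqmod d (a ^ n * a ^ n) (a ^ n)"
  obtains t u where "t \<in> \<O>" "u \<in> \<O>" "eqmod d ((a + t * c) * u) 1"
proof -
  define e where "e = a ^ n"
  \<comment> \<open>Modulo \<open>d\<close>, \<open>f\<close> inverts \<open>a\<close> on the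
    component \<open>e\<close>, since \<open>a * f = e\<close>, and \<open>S\<close> inverts
    \<open>1 - (x - 1) * a\<close> on the component \<open>1 - e\<close>, up to the error
    \<open>w * e\<close>, which vanishes there. Glued together they give the inverse
    \<open>f * e + (1 - e) * S\<close>.\<close>
  define S where "S = (\<Sum>i<n. ((x - 1) * a) ^ i)"
  define f where "f = a ^ (n - 1)"
  define w where "w = (x - 1) ^ n"
  have mem: "e \<in> \<O>" "S \<in> \<O>" "f \<in> \<O>" "w \<in> \<O>"
    unfolding e_def S_def f_def w_def using O by (auto intro!: integers_sum)
  obtain z where z: "z \<in> \<O>" "e * e = e + d * z"
    using n(2) by (auto simp: eqmod_def e_def algebra_simps)
  have af: "a * f = e" 
    using n(1) by (simp add: e_def f_def flip: power_Suc)
  have S: "(1 - (x - 1) * a) * S = 1 - w * e"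
    using one_diff_power_eq[of "(x - 1) * a" n] by (simp add: S_def w_def e_def power_mult_distrib)
  have yc: "y * c = 1 - x * a" using bezout by (simp add: algebra_simps)
  have "(a + (1 - e) * y * c) * (f * e + (1 - e) * S) - 1 =
      (a + (1 - e) * (1 - x * a)) * (f * e + (1 - e) * S) - 1"
    by (simp add: mult.assoc yc)
  also have "\<dots> = (a * f) * e + (e - e * e) * (1 - x * a) * f + (1 - e) * ((1 - (x - 1) * a) * S)
                    - (e - e * e) * (1 - x * a) * S - 1"
    by (simp add: algebra_simps)
  also have "\<dots> = e * e + (e - e * e) * (1 - x * a) * f + (1 - e - w * e + w * (e * e))
                    - (e - e * e) * (1 - x * a) * S - 1"
    unfolding af S by (simp add: algebra_simps)
  \<comment> \<open>After cancellation every remaining term contains \<open>e * e - e\<close>, which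
    is \<open>d * z\<close>.\<close>
  also have "\<dots> = d * (z * (1 - (1 - x * a) * f + (1 - x * a) * S + w))"
    unfolding z(2) by (simp add: algebra_simps)
  moreover have "z * (1 - (1 - x * a) * f + (1 - x * a) * S + w) \<in> \<O>"
    using O mem z(1) by auto
  ultimately have "eqmod d ((a + (1 - e) * y * c) * (f * e + (1 - e) * S)) 1"
    unfolding eqmod_def by metis
  thus ?thesis
    using that[of "(1 - e) * y" "f * e + (1 - e) * S"] O mem by auto
qed

end

section \<open>Finiteness of the residues modulo a positive integer\<close>

locale integers_with_basis = integers_of_number_field F for F :: "'a::field_char_0 set" +
  fixes n :: nat and w :: "nat \<Rightarrow> 'a"
  assumes basis: "integral_basis F n w"
begin

lemma span_basis: "int_module.span (w ` {1..n}) = \<O>"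
  using basis by (simp add: integral_basis_def)

text \<open>Reducing the integer coordinates of an element modulo \<open>D\<close> leaves only
  finitely many representatives.\<close>

lemma finite_residues:
  assumes "D > 0"
  obtains S where "finite S" "\<And>x. x \<in> \<O> \<Longrightarrow> \<exists>s\<in>S. eqmod (of_nat D) x s"
proof -
  define B where "B = w ` {1..n}"
  have fin: "finite B" by (simp add: B_def)
  have BO: "B \<subseteq> \<O>" using int_module.span_superset[of B] span_basis by (simp add: B_def)
  define S where "S = (\<lambda>r. \<Sum>b\<in>B. of_int (r b) * b) ` (PiE B (\<lambda>_. {0..<int D}))"
  have "finite S" unfolding S_def by (intro finite_imageI finite_PiE fin) simp
  moreover have "\<exists>s\<in>S. eqmod (of_nat D) x s" if "x \<in> \<O>" for x
  proof -
    have "x \<in> int_module.span B" using that span_basis by (simp add: B_def)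
    then obtain k where k: "x = (\<Sum>b\<in>B. of_int (k b) * b)"
      using int_module.span_finite[OF fin] by auto
    define r where "r = restrict (\<lambda>b. k b mod int D) B"
    have "(\<Sum>b\<in>B. of_int (r b) * b) \<in> S"
      unfolding S_def using assms by (intro imageI) (auto simp: r_def)
    moreover have "x - (\<Sum>b\<in>B. of_int (r b) * b) = of_nat D * (\<Sum>b\<in>B. of_int (k b div int D) * b)"
    proof -
      have "of_int (k b) * b - of_int (r b) * b = of_nat D * (of_int (k b div int D) * b)"
        if "b \<in> B" for b
      proof -
        have "k b = int D * (k b div int D) + r b"
          using that by (simp add: r_def)
        hence "(of_int (k b) :: 'a) = of_nat D * of_int (k b div int D) + of_int (r b)"
          by (metis of_int_add of_int_mult of_int_of_nat_eq)
        thus ?thesis by (simp add: algebra_simps)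
      qed
      thus ?thesis unfolding k by (simp add: sum_subtractf[symmetric] sum_distrib_left)
    qed
    moreover have "(\<Sum>b\<in>B. of_int (k b div int D) * b) \<in> \<O>"
      using BO by (intro integers_sum) auto
    ultimately show ?thesis unfolding eqmod_def by blast
  qed
  ultimately show ?thesis using that by blast
qed

text \<open>By the pigeonhole principle the powers of \<open>a\<close> modulo \<open>D\<close> are
  eventually periodic. If \<open>k\<close> is a multiple of the period and lies beyond the
  preperiod, then \<open>a ^ (2 * k)\<close> and \<open>a ^ k\<close> agree.\<close>

lemma power_idempotent_mod:
  assumes a: "a \<in> \<O>" and "D > 0"
  obtains k where "k > 0" "eqmod (of_nat D) (a ^ k * a ^ k) (a ^ k)"
proof -
  obtain S where S: "finite S" "\<And>x. x \<in> \<O> \<Longrightarrow> \<exists>s\<in>S. eqmod (of_nat D) x s"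
    using finite_residues[OF assms(2)] by blast
  hence "\<exists>s\<in>S. eqmod (of_nat D) (a ^ i) s" for i using a by blast
  then obtain r where r: "\<And>i. r i \<in> S" "\<And>i. eqmod (of_nat D) (a ^ i) (r i)"
    by metis
  have "\<not> inj r"
    using r(1) S(1) by (metis finite_imageD finite_subset image_subsetI infinite_UNIV_nat)
  then obtain i j where ij: "i < j" "r i = r j"
    by (metis injI linorder_neqE_nat)
  define p where "p = j - i"
  have p: "p > 0" "j = i + p" using ij by (auto simp: p_def)
  have base: "eqmod (of_nat D) (a ^ (i + p)) (a ^ i)"
    using r(2)[of i] r(2)[of j] ij(2) p(2) eqmod_sym eqmod_trans by metis
  have shift: "eqmod (of_nat D) (a ^ (i + l + p * q)) (a ^ (i + l))" for l q
  proof (induction q)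
    case (Suc q)
    have "eqmod (of_nat D) (a ^ (l + p * q) * a ^ (i + p)) (a ^ (l + p * q) * a ^ i)"
      using base a by (intro eqmod_mult_left) auto
    also have "a ^ (l + p * q) * a ^ i = a ^ (i + l + p * q)"
      by (simp add: power_add mult_ac)
    also note Suc
    finally show ?case by (simp add: power_add mult_ac)
  qed simp
  \<comment> \<open>\<open>Suc i\<close> instead of \<open>i\<close> keeps \<open>k\<close> positive
    when \<open>i = 0\<close>.\<close>
  define k where "k = p * Suc i"
  have "k \<ge> i" using p(1) unfolding k_def by (metis Suc_leD mult_le_mono1 nat_mult_1 Suc_leI One_nat_def)
  hence "eqmod (of_nat D) (a ^ (k + k)) (a ^ k)"
    using shift[of "k - i" "Suc i"] by (simp add: k_def)
  moreover have "k > 0" using p(1) by (simp add: k_def)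
  ultimately show ?thesis using that by (simp add: power_add)
qed

end

section \<open>Elementary matrices and the level\<close>

definition mat2 :: "'a::comm_ring_1 \<Rightarrow> 'a \<Rightarrow> 'a \<Rightarrow> 'a \<Rightarrow> 'a^2^2" where
  "mat2 a b c d = vector [vector [a, b], vector [c, d]]"

lemma mat2_nth [simp]:
  "Finite_Cartesian_Product.vec_nth (Finite_Cartesian_Product.vec_nth (mat2 a b c d) 1) 1 = a"
  "Finite_Cartesian_Product.vec_nth (Finite_Cartesian_Product.vec_nth (mat2 a b c d) 1) 2 = b"
  "Finite_Cartesian_Product.vec_nth (Finite_Cartesian_Product.vec_nth (mat2 a b c d) 2) 1 = c"
  "Finite_Cartesian_Product.vec_nth (Finite_Cartesian_Product.vec_nth (mat2 a b c d) 2) 2 = d"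
  by (simp_all add: mat2_def)

lemma mat2_cases:
  fixes M :: "'a::comm_ring_1^2^2"
  obtains a b c d where "M = mat2 a b c d"
proof
  show "M = mat2 (Finite_Cartesian_Product.vec_nth (Finite_Cartesian_Product.vec_nth M 1) 1)
    (Finite_Cartesian_Product.vec_nth (Finite_Cartesian_Product.vec_nth M 1) 2)
    (Finite_Cartesian_Product.vec_nth (Finite_Cartesian_Product.vec_nth M 2) 1)
    (Finite_Cartesian_Product.vec_nth (Finite_Cartesian_Product.vec_nth M 2) 2)"
    by (simp add: Finite_Cartesian_Product.vec_eq_iff forall_2)
qed

lemma mat2_mult:
  "mat2 a b c d ** mat2 a' b' c' d' =
     mat2 (a * a' + b * c') (a * b' + b * d') (c * a' + d * c') (c * b' + d * d')"
  by (simp add: Finite_Cartesian_Product.vec_eq_iff forall_2 matrix_matrix_mult_def sum_2)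

lemma mat2_one: "Finite_Cartesian_Product.mat 1 = mat2 1 0 0 1"
  by (simp add: Finite_Cartesian_Product.vec_eq_iff forall_2 Finite_Cartesian_Product.mat_def)

lemma upper_unipotent_mat2: "upper_unipotent x = mat2 1 x 0 1"
  by (simp add: upper_unipotent_def mat2_def)

lemma mat2_in_SL2: "mat2 a b c d \<in> carrier (SL2 A) \<longleftrightarrow>
    a \<in> A \<and> b \<in> A \<and> c \<in> A \<and> d \<in> A \<and> a * d - b * c = 1"
  by (auto simp: SL2_def det_2 forall_2)

lemma SL2_simps [simp]: "mult (SL2 A) = (**)" "one (SL2 A) = mat2 1 0 0 1"
  by (simp_all add: SL2_def mat2_one)

context integers_of_number_field
begin

abbreviation \<Gamma> where "\<Gamma> \<equiv> SL2 \<O>"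

lemma mat2_in_principal_congruence_subgroup:
  "mat2 a b c d \<in> principal_congruence_subgroup F I \<longleftrightarrow>
     mat2 a b c d \<in> carrier \<Gamma> \<and> a - 1 \<in> I \<and> d - 1 \<in> I \<and> b \<in> I \<and> c \<in> I"
  by (auto simp: principal_congruence_subgroup_def)

text \<open>The adjugate is the inverse because the determinant is 1. At each use
  \<open>group \<Gamma>\<close> comes from the normality of a subgroup.\<close>

lemma inv_mat2:
  assumes "group \<Gamma>" "mat2 a b c d \<in> carrier \<Gamma>"
  shows "inv\<^bsub>\<Gamma>\<^esub> (mat2 a b c d) = mat2 d (- b) (- c) a"
  using assms by (intro group.inv_equality) (auto simp: mat2_mult mat2_in_SL2 algebra_simps)

lemma normal_conjugate_mat2:
  assumes "normal N \<Gamma>" "h \<in> N" "mat2 a b c d \<in> carrier \<Gamma>"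
  shows "mat2 a b c d ** h ** mat2 d (- b) (- c) a \<in> N"
  using normal.inv_op_closed2[OF assms(1,3,2)] inv_mat2[OF _ assms(3)] assms(1)
  by (simp add: normal_def)

text \<open>Upper unipotent matrices multiply by adding their entries. Differences, together with
  the identity, give negatives and sums as well.\<close>

lemma upper_unipotent_diff:
  assumes "normal N \<Gamma>" "mat2 1 x 0 1 \<in> N" "mat2 1 y 0 1 \<in> N"
  shows "mat2 1 (x - y) 0 1 \<in> N"
proof -
  have N: "subgroup N \<Gamma>" "group \<Gamma>" using assms(1) by (simp_all add: normal_def)
  have "mat2 1 x 0 1 \<otimes>\<^bsub>\<Gamma>\<^esub> inv\<^bsub>\<Gamma>\<^esub> mat2 1 y 0 1 \<in> N"
    using assms(2,3) by (intro subgroup.m_closed[OF N(1)] subgroup.m_inv_closed[OF N(1)])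
  thus ?thesis
    using subgroup.mem_carrier[OF N(1) assms(3)] by (simp add: inv_mat2 N(2) mat2_mult)
qed

lemma upper_unipotent_int_mult:
  assumes "normal N \<Gamma>" "mat2 1 x 0 1 \<in> N"
  shows "mat2 1 (of_int k * x) 0 1 \<in> N"
proof -
  have "subgroup N \<Gamma>" using assms(1) by (simp add: normal_def)
  from subgroup.one_closed[OF this] have 0: "mat2 1 0 0 1 \<in> N" by simp
  have neg: "mat2 1 (- x) 0 1 \<in> N" using upper_unipotent_diff[OF assms(1) 0 assms(2)] by simp
  show ?thesis
  proof (induction k rule: int_induct[of _ 0])
    case base
    show ?case using 0 by simp
  next
    case (step1 k)
    from upper_unipotent_diff[OF assms(1) step1(2) neg] show ?case by (simp add: distrib_right)
  next
    case (step2 k)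
    from upper_unipotent_diff[OF assms(1) step2(2) assms(2)] show ?case by (simp add: left_diff_distrib)
  qed
qed

text \<open>Conjugation by the Weyl element \<open>mat2 0 (- 1) 1 0\<close> exchanges upper and
  lower unipotents and changes the sign of the entry.\<close>

lemma lower_unipotent_mem:
  assumes "normal N \<Gamma>" "mat2 1 (- x) 0 1 \<in> N"
  shows "mat2 1 0 x 1 \<in> N"
  using normal_conjugate_mat2[OF assms, of 0 "- 1" 1 0] by (simp add: mat2_mult mat2_in_SL2)

end

section \<open>The level subgroup and reduction modulo \<open>D\<close>\<close>

context integers_with_basis
begin

text \<open>The entries of the upper unipotents in \<open>N\<close> form an additive group, so the
  multiples of the basis elements by \<open>m\<close> yield all of \<open>m\<O>\<close>.\<close>

lemma upper_unipotent_mem_if_basis: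
  assumes "normal N \<Gamma>" "\<And>i. i \<in> {1..n} \<Longrightarrow> mat2 1 (of_nat m * w i) 0 1 \<in> N" "x \<in> \<O>"
  shows "mat2 1 (of_nat m * x) 0 1 \<in> N"
proof -
  have "x \<in> int_module.span (w ` {1..n})" using assms(3) span_basis by simp
  thus ?thesis
  proof (induction rule: int_module.span_induct_alt)
    case base
    show ?case using upper_unipotent_int_mult[OF assms(1), of _ 0] subgroup.one_closed[of N \<Gamma>] assms(1) 
      by (simp add: normal_def)
  next
    case (step k c u)
    have "mat2 1 (of_int (- k) * (of_nat m * c)) 0 1 \<in> N"
      using step assms(2) by (intro upper_unipotent_int_mult[OF assms(1)]) auto
    from upper_unipotent_diff[OF assms(1) step(2) this]
    show ?case by (simp add: algebra_simps)
  qed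
qed

text \<open>Since the level subgroup is an intersection of normal subgroups, it suffices to argue in
  an arbitrary such \<open>N\<close>, where all upper and lower unipotents with entries in
  \<open>m\<O>\<close> are at hand.\<close>

lemma in_level_subgroupI:
  assumes "\<And>N. normal N \<Gamma> \<Longrightarrow> (\<And>x. x \<in> \<O> \<Longrightarrow> mat2 1 (of_nat m * x) 0 1 \<in> N) \<Longrightarrow>
             (\<And>x. x \<in> \<O> \<Longrightarrow> mat2 1 0 (of_nat m * x) 1 \<in> N) \<Longrightarrow> M \<in> N"
  shows "M \<in> level_subgroup F n w m"
  unfolding level_subgroup_def normal_closure_def
proof (intro InterI, clarify)
  fix N assume N: "normal N \<Gamma>"
    and sub: "generate \<Gamma> ((\<lambda>i. upper_unipotent (of_nat m * w i)) ` {1..n}) \<subseteq> N"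
  have gen: "mat2 1 (of_nat m * w i) 0 1 \<in> N" if "i \<in> {1..n}" for i
    using sub that by (auto simp: upper_unipotent_mat2[symmetric] intro!: generate.incl)
  have U: "mat2 1 (of_nat m * x) 0 1 \<in> N" if "x \<in> \<O>" for x
    using upper_unipotent_mem_if_basis[OF N gen that] .
  show "M \<in> N"
    by (rule assms[OF N U]) (use U[of "- _"] in \<open>auto intro!: lower_unipotent_mem[OF N]\<close>)
qed

text \<open>The conjugate \<open>mat2 a (-q) q (2 - a)\<close> of \<open>mat2 1 (-q) 0 1\<close>, where \<open>q = a - 1\<close>, realises the
  corner \<open>a\<close> inside the level subgroup; multiplying by unipotents with entries \<open>l\<close> and \<open>v\<close>
  then adjusts the off-diagonal entries modulo \<open>D\<close>.\<close>

lemma principal_congruence_reduction: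
  assumes A: "mat2 a b c d \<in> carrier \<Gamma>"
    and m: "a - 1 = of_nat m * a1" "b = of_nat m * b1" "c = of_nat m * c1"
    and mem: "a1 \<in> \<O>" "b1 \<in> \<O>" "c1 \<in> \<O>"
    and u: "u \<in> \<O>" "eqmod D (a * u) 1"
  obtains M b' c' d' where "M = mat2 a b' c' d'" "M \<in> level_subgroup F n w m"
    "M \<in> carrier \<Gamma>" "eqmod D b' b" "eqmod D c' c"
proof -
  define q where "q = a - 1"
  \<comment> \<open>As \<open>u\<close> inverts \<open>a\<close> modulo \<open>D\<close>, these
    values solve \<open>l * a + q = c\<close> and \<open>a * v - q = b\<close> modulo
    \<open>D\<close>. Both are multiples of \<open>m\<close>, so the corresponding unipotents are
    available in the level subgroup.\<close>
  define l where "l = (c - q) * u"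
  define v where "v = (b + q) * u"
  have q: "q = of_nat m * a1" "q \<in> \<O>" using m(1) mem(1) by (auto simp: q_def)
  have l: "l = of_nat m * ((c1 - a1) * u)" and v: "v = of_nat m * ((b1 + a1) * u)"
    unfolding l_def v_def q(1) m(2,3) by (simp_all add: algebra_simps)
  have lv: "l \<in> \<O>" "v \<in> \<O>" using l v mem u by auto
  have O: "a \<in> \<O>" "b \<in> \<O>" "c \<in> \<O>" "d \<in> \<O>" using A by (auto simp: mat2_in_SL2)
  define M where "M = mat2 1 0 l 1 ** (mat2 1 0 1 1 ** mat2 1 (- q) 0 1 ** mat2 1 0 (- 1) 1) ** mat2 1 v 0 1"
  have M: "M = mat2 a (a * v - q) (l * a + q) ((l * a + q) * v + (1 - q * l - q))"
    by (simp add: M_def mat2_mult q_def algebra_simps)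
  have "M \<in> level_subgroup F n w m"
  proof (rule in_level_subgroupI)
    fix N assume N: "normal N \<Gamma>" and U: "\<And>x. x \<in> \<O> \<Longrightarrow> mat2 1 (of_nat m * x) 0 1 \<in> N"
      and L: "\<And>x. x \<in> \<O> \<Longrightarrow> mat2 1 0 (of_nat m * x) 1 \<in> N"
    have sub: "subgroup N \<Gamma>" using N by (simp add: normal_def)
    have "mat2 1 (- q) 0 1 \<in> N" using U[of "- a1"] mem q by simp
    hence "mat2 1 0 1 1 ** mat2 1 (- q) 0 1 ** mat2 1 0 (- 1) 1 \<in> N"
      using normal_conjugate_mat2[OF N, of _ 1 0 1 1] by (simp add: mat2_in_SL2)
    moreover have "mat2 1 0 l 1 \<in> N" "mat2 1 v 0 1 \<in> N"
      unfolding l v using mem u by (auto intro!: L U)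
    ultimately show "M \<in> N" unfolding M_def using subgroup.m_closed[OF sub] by simp
  qed
  moreover have "M \<in> carrier \<Gamma>"
  proof -
    have "a * ((l * a + q) * v + (1 - q * l - q)) - (a * v - q) * (l * a + q) = a - q * (a - q)"
      by (simp add: algebra_simps)
    also have "\<dots> = 1" by (simp add: q_def)
    finally have "a * ((l * a + q) * v + (1 - q * l - q)) - (a * v - q) * (l * a + q) = 1" .
    thus ?thesis unfolding M mat2_in_SL2 using O(1) q(2) lv by simp
  qed
  moreover have "eqmod D (a * v - q) b"
  proof -
    have "eqmod D ((b + q) * (a * u) + - q) ((b + q) * 1 + - q)"
      using O q u by (intro eqmod_add eqmod_mult_left) auto
    thus ?thesis by (simp add: v_def algebra_simps)
  qed
  moreover have "eqmod D (l * a + q) c"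
  proof -
    have "eqmod D ((c - q) * (a * u) + q) ((c - q) * 1 + q)"
      using O q u by (intro eqmod_add eqmod_mult_left) auto
    thus ?thesis by (simp add: l_def algebra_simps)
  qed
  ultimately show ?thesis using that M by blast
qed

text \<open>The matrix \<open>M\<close> of the reduction lies in \<open>K\<close> and agrees with
  the given matrix modulo \<open>D\<close> in three entries. The fourth follows because both
  determinants are 1 and \<open>a\<close> is a unit modulo \<open>D\<close>. Hence the two differ by
  a factor in \<Gamma>(D), which lies in \<open>K\<close>.\<close>

lemma principal_congruence_unit_corner:
  assumes A: "mat2 a b c d \<in> carrier \<Gamma>"
    and m: "a - 1 = of_nat m * a1" "b = of_nat m * b1" "c = of_nat m * c1"
    and mem: "a1 \<in> \<O>" "b1 \<in> \<O>" "c1 \<in> \<O>"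
    and u: "u \<in> \<O>" "eqmod D (a * u) 1"
    and K: "subgroup K \<Gamma>" "level_subgroup F n w m \<subseteq> K"
      "principal_congruence_subgroup F {D * z | z. z \<in> \<O>} \<subseteq> K"
  shows "mat2 a b c d \<in> K"
proof -
  obtain M b' c' d' where M: "M = mat2 a b' c' d'" "M \<in> level_subgroup F n w m"
    "M \<in> carrier \<Gamma>" "eqmod D b' b" "eqmod D c' c"
    using principal_congruence_reduction[OF A m mem u] by blast
  have O: "a \<in> \<O>" "b \<in> \<O>" "c \<in> \<O>" "d \<in> \<O>" and det: "a * d - b * c = 1"
    using A by (auto simp: mat2_in_SL2)
  have O': "b' \<in> \<O>" "c' \<in> \<O>" "d' \<in> \<O>" and det': "a * d' - b' * c' = 1"
    using M by (auto simp: mat2_in_SL2)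
  obtain s where s: "s \<in> \<O>" "b' - b = D * s" using M(4) by (auto simp: eqmod_def)
  obtain t where t: "t \<in> \<O>" "c' - c = D * t" using M(5) by (auto simp: eqmod_def)
  obtain r where r: "r \<in> \<O>" "a * u - 1 = D * r" using u by (auto simp: eqmod_def)
  \<comment> \<open>The quotient of \<open>d' - d\<close> by \<open>D\<close>: comparing
    determinants shows that \<open>D\<close> divides \<open>a * (d' - d)\<close>, and multiplying by
    \<open>u\<close> removes \<open>a\<close> up to a multiple of \<open>D\<close>.\<close>
  define dd where "dd = (b' * t + s * c) * u - r * (d' - d)"
  have "a * (d' - d) = b' * c' - b * c" using det det' by (simp add: algebra_simps)
  also have "\<dots> = b' * (c' - c) + (b' - b) * c" by (simp add: algebra_simps)
  also have "\<dots> = D * (b' * t + s * c)" unfolding s t by (simp add: algebra_simps)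
  finally have ad: "a * (d' - d) = D * (b' * t + s * c)" .
  have "d' - d = u * (a * (d' - d)) - (a * u - 1) * (d' - d)" by (simp add: algebra_simps)
  also have "\<dots> = D * dd" unfolding ad r dd_def by (simp add: algebra_simps)
  finally have d: "d' - d = D * dd" .
  have ddO: "dd \<in> \<O>" unfolding dd_def using O O' s t r u by auto
  \<comment> \<open>This is the inverse of \<open>M\<close>, written as its adjugate, times the
    given matrix.\<close>
  let ?g = "mat2 (d' * a - b' * c) (d' * b - b' * d) (a * c - c' * a) (a * d - c' * b)"
  have g1: "d' * a - b' * c - 1 = D * (b' * t)"
  proof -
    have "d' * a - b' * c - 1 = b' * (c' - c)" unfolding det'[symmetric] by (simp add: algebra_simps)
    thus ?thesis by (simp add: t)
  qed
  have g2: "d' * b - b' * d = D * (dd * b - s * d)"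
  proof -
    have "d' * b - b' * d = (d' - d) * b - (b' - b) * d" by (simp add: algebra_simps)
    thus ?thesis by (simp add: s d algebra_simps)
  qed
  have g3: "a * c - c' * a = D * (- (a * t))"
  proof -
    have "a * c - c' * a = - (a * (c' - c))" by (simp add: algebra_simps)
    thus ?thesis by (simp add: t)
  qed
  have g4: "a * d - c' * b - 1 = D * (- (b * t))"
  proof -
    have "a * d - c' * b - 1 = - (b * (c' - c))" unfolding det[symmetric] by (simp add: algebra_simps)
    thus ?thesis by (simp add: t)
  qed
  have "(d' * a - b' * c) * (a * d - c' * b) - (d' * b - b' * d) * (a * c - c' * a) =
          (a * d' - b' * c') * (a * d - b * c)"
    by (simp add: algebra_simps)
  hence "(d' * a - b' * c) * (a * d - c' * b) - (d' * b - b' * d) * (a * c - c' * a) = 1"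
    unfolding det det' by simp
  hence "?g \<in> carrier \<Gamma>"
    unfolding mat2_in_SL2 using O O' by blast
  hence "?g \<in> principal_congruence_subgroup F {D * z | z. z \<in> \<O>}"
    unfolding mat2_in_principal_congruence_subgroup g1 g2 g3 g4
    using O O' s t ddO by blast
  hence "M ** ?g \<in> K"
    using subgroup.m_closed[OF K(1)] M(2) K(2,3) by auto
  moreover have "M ** ?g = mat2 a b c d"
  proof -
    have "M ** ?g = mat2 ((a * d' - b' * c') * a) ((a * d' - b' * c') * b)
        ((a * d' - b' * c') * c) ((a * d' - b' * c') * d)"
      unfolding M(1) mat2_mult by (simp add: algebra_simps)
    thus ?thesis unfolding det' by simp
  qed
  ultimately show ?thesis by simp
qed

text \<open>Stable range one makes the upper left corner a unit modulo \<open>D\<close> by a factor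
  from the level subgroup, which reduces the general case to a unit corner.\<close>

lemma principal_congruence_subgroup_subset:
  assumes K: "subgroup K \<Gamma>" "level_subgroup F n w m \<subseteq> K"
      "principal_congruence_subgroup F {of_nat D * z | z. z \<in> \<O>} \<subseteq> K" and D: "D > 0"
  shows "principal_congruence_subgroup F {of_nat m * z | z. z \<in> \<O>} \<subseteq> K"
proof
  fix A assume A: "A \<in> principal_congruence_subgroup F {of_nat m * z | z. z \<in> \<O>}"
  obtain a b c d where A_eq: "A = mat2 a b c d" using mat2_cases .
  obtain a1 b1 c1 where m: "a - 1 = of_nat m * a1" "b = of_nat m * b1" "c = of_nat m * c1"
    and mem: "a1 \<in> \<O>" "b1 \<in> \<O>" "c1 \<in> \<O>" and carr: "mat2 a b c d \<in> carrier \<Gamma>"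
    using A unfolding A_eq mat2_in_principal_congruence_subgroup by blast
  have O: "a \<in> \<O>" "b \<in> \<O>" "c \<in> \<O>" "d \<in> \<O>" and det: "a * d - b * c = 1"
    using carr by (auto simp: mat2_in_SL2)
  obtain k where k: "k > 0" "eqmod (of_nat D) (a ^ k * a ^ k) (a ^ k)"
    using power_idempotent_mod[OF O(1) D] .
  \<comment> \<open>The determinant relates \<open>a\<close> and \<open>b\<close>, but the corner
    may only be changed by multiples of \<open>m * b\<close>, to stay among unipotents with entries
    in \<open>m\<O>\<close>. Since \<open>a\<close> is 1 modulo \<open>m\<close>, \<open>a\<close>
    is coprime to \<open>m * b\<close> too.\<close>
  have "(d - b * c) * a + c * a1 * (of_nat m * b) = a * d - b * c + b * c * (1 + of_nat m * a1 - a)"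
    by (simp add: algebra_simps)
  also have "\<dots> = 1" unfolding m(1)[symmetric] det by simp
  finally have bezout: "(d - b * c) * a + - (c * a1) * (- of_nat m * b) = 1" by simp
  have "- of_nat m * b \<in> \<O>" "d - b * c \<in> \<O>" "- (c * a1) \<in> \<O>"
    using O mem by simp_all
  then obtain t u where t: "t \<in> \<O>"
    and u: "u \<in> \<O>" "eqmod (of_nat D) ((a + t * (- of_nat m * b)) * u) 1"
    using eqmod_unit_stable[OF O(1) _ _ _ bezout k] by blast
  let ?L = "mat2 1 0 (of_nat m * t) 1"
  have L: "?L \<in> K"
    using in_level_subgroupI[of m ?L] t K(2) by blast
  \<comment> \<open>This is \<open>A\<close> times the inverse of \<open>?L\<close>; its corner is
    the unit just found.\<close>
  have "mat2 (a - of_nat m * t * b) b (c - of_nat m * t * d) d \<in> K"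
  proof (rule principal_congruence_unit_corner[where D = "of_nat D"])
    have "(a - of_nat m * t * b) * d - b * (c - of_nat m * t * d) = a * d - b * c"
      by (simp add: algebra_simps)
    thus "mat2 (a - of_nat m * t * b) b (c - of_nat m * t * d) d \<in> carrier \<Gamma>"
      unfolding mat2_in_SL2 det using O t by blast
    show "a - of_nat m * t * b - 1 = of_nat m * (a1 - t * b)" using m(1) by (simp add: algebra_simps)
    show "c - of_nat m * t * d = of_nat m * (c1 - t * d)" using m(3) by (simp add: algebra_simps)
    show "eqmod (of_nat D) ((a - of_nat m * t * b) * u) 1" using u(2) by (simp add: algebra_simps)
    show "b = of_nat m * b1" by (fact m(2))
    show "a1 - t * b \<in> \<O>" "b1 \<in> \<O>" "c1 - t * d \<in> \<O>" using O t mem by simp_all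
  qed (fact u(1), fact K(1), fact K(2), fact K(3))
  hence "mat2 (a - of_nat m * t * b) b (c - of_nat m * t * d) d ** ?L \<in> K"
    using subgroup.m_closed[OF K(1) _ L] by simp
  thus "A \<in> K" by (simp add: A_eq mat2_mult algebra_simps)
qed

end

theorem theorem3p4:
  fixes F :: "'a::field_char_0 set" and n m :: nat and w :: "nat \<Rightarrow> 'a" and K :: "('a^2^2) set"
  assumes "number_field F"
    and "integral_basis F n w" and "w 1 = 1"
    and "subgroup K (SL2 (integers_of F))"
    and "finite (rcosets\<^bsub>SL2 (integers_of F)\<^esub> K)"
    and "has_level F n w K m"
  shows "congruence_subgroup F K \<longleftrightarrow>
    principal_congruence_subgroup F (PIdl\<^bsub>integers_ring F\<^esub> (of_nat m)) \<subseteq> K"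
proof
  interpret integers_with_basis F n w
    using assms by unfold_locales
  have m: "m > 0" "level_subgroup F n w m \<subseteq> K"
    using assms(6) by (auto simp: has_level_def)
  show "principal_congruence_subgroup F (PIdl\<^bsub>integers_ring F\<^esub> (of_nat m)) \<subseteq> K"
    if K: "congruence_subgroup F K"
  proof -
    obtain I where I: "ideal I (integers_ring F)" "I \<noteq> {0}"
      "principal_congruence_subgroup F I \<subseteq> K"
      using K by (auto simp: congruence_subgroup_def)
    obtain D where D: "D > 0" "of_nat D \<in> I"
      using nonzero_ideal_contains_pos_nat[OF I(1,2)] .
    \<comment> \<open>A smaller ideal has a smaller principal congruence subgroup, so \<Gamma>(D)
      also lies in \<open>K\<close>.\<close>
    have "{of_nat D * z | z. z \<in> \<O>} \<subseteq> I"
      using ideal_mult_closed[OF I(1) D(2)] by auto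
    hence "principal_congruence_subgroup F {of_nat D * z | z. z \<in> \<O>} \<subseteq> K"
      using I(3) by (auto simp: principal_congruence_subgroup_def)
    thus ?thesis
      unfolding PIdl_integers_ring
      using principal_congruence_subgroup_subset[OF assms(4) m(2) _ D(1)] by simp
  qed
  show "congruence_subgroup F K"
    if "principal_congruence_subgroup F (PIdl\<^bsub>integers_ring F\<^esub> (of_nat m)) \<subseteq> K"
  proof -
    \<comment> \<open>The ideal generated by \<open>m\<close> itself witnesses the congruence
      property; it is nonzero as \<open>m > 0\<close> in characteristic zero.\<close>
    have "ideal (PIdl\<^bsub>integers_ring F\<^esub> (of_nat m)) (integers_ring F)"
      by (rule cring.cgenideal_ideal[OF cring_integers_ring]) (simp add: integers_ring_def)
    moreover have "of_nat m * 1 \<in> PIdl\<^bsub>integers_ring F\<^esub> (of_nat m)"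
      unfolding PIdl_integers_ring by blast
    hence "PIdl\<^bsub>integers_ring F\<^esub> (of_nat m) \<noteq> {0}"
      using m(1) by (metis mult_1_right of_nat_eq_0_iff order_less_irrefl singletonD)
    ultimately show ?thesis
      unfolding congruence_subgroup_def using that assms(4) by blast
  qed
qed

end
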